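(* Let $n\ge1$ and let $\rho,\sigma\in DO(n)$ be states. Then $\rho\sqsubseteq\sigma$ if and only if there exists an effect $E\in M_n$ (i.e. $0\le E\le I_n$) with $\operatorname{tr}(E\rho)\neq 0$ such that $$\sigma=\frac{\rho^{1/2}E\rho^{1/2}}{\operatorname{tr}(E\rho)}\qquad\text{and}\qquad L^+(E)\cap L^+(\rho)\neq\{0\}.$$
   Context: $M_n$ denotes the complex $n\times n$ matrices. A state is an element of $DO(n)=\{A\in M_n : A\ge 0,\ \operatorname{tr}A=1\}$, where $A\ge0$ means positive semidefinite and $A\le B$ means $B-A\ge 0$. For a positive semidefinite matrix $A$, $A^+$ is its highest eigenvalue (equal to the operator norm $\|A\|$), and $L^+(A)=\{v\in\mathbb{C}^n : Av=A^+v\}$ is the corresponding eigenspace. $\rho^{1/2}$ is the positive semidefinite square root. The QPE order on $DO(n)$ is the relation $$\rho\sqsubseteq\sigma \iff \frac{\sigma}{\sigma^+}\le\frac{\rho}{\rho^+}\iff \sigma^+\rho-\rho^+\sigma\ge 0 .$$ *)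

theory Defs
  imports "HOL-Analysis.Analysis"
begin

text \<open>
  Complex \<open>n \<times> n\<close> matrices have type \<open>complex^'n^'n\<close>, with \<open>n = CARD('n)\<close>; the index type is
  nonempty, so \<open>n \<ge> 1\<close>. The inner product of the library on \<open>complex^'n\<close> is the real one, hence
  the sesquilinear form below.
\<close>

definition cinner :: "complex^'n \<Rightarrow> complex^'n \<Rightarrow> complex" where
  "cinner v w = (\<Sum>i\<in>UNIV. cnj (v $ i) * w $ i)"

definition adjoint_mat :: "complex^'n^'n \<Rightarrow> complex^'n^'n" where
  "adjoint_mat A = (\<chi> i j. cnj (A $ j $ i))"

definition hermitian :: "complex^'n^'n \<Rightarrow> bool" where
  "hermitian A \<longleftrightarrow> adjoint_mat A = A"

text \<open>Taking the real part is harmless: \<open>cinner v (A *v v)\<close> is real for hermitian \<open>A\<close>.\<close>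

definition psd :: "complex^'n^'n \<Rightarrow> bool" where
  "psd A \<longleftrightarrow> hermitian A \<and> (\<forall>v. 0 \<le> Re (cinner v (A *v v)))"

definition loewner_le :: "complex^'n^'n \<Rightarrow> complex^'n^'n \<Rightarrow> bool"  (infix \<open>\<le>\<^sub>L\<close> 50) where
  "A \<le>\<^sub>L B \<longleftrightarrow> psd (B - A)"

definition states :: "(complex^'n^'n) set" where
  "states = {A. psd A \<and> trace A = 1}"

definition effect :: "complex^'n^'n \<Rightarrow> bool" where
  "effect E \<longleftrightarrow> 0 \<le>\<^sub>L E \<and> E \<le>\<^sub>L mat 1"

text \<open>
  The highest eigenvalue \<open>A\<^sup>+\<close>, used for positive semidefinite \<open>A\<close> only: then all eigenvalues are
  real, and they form a finite nonempty set, so that \<^const>\<open>Max\<close> is meaningful.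
\<close>

definition max_eigenvalue :: "complex^'n^'n \<Rightarrow> real" where
  "max_eigenvalue A = Max {r. \<exists>v. v \<noteq> 0 \<and> A *v v = complex_of_real r *s v}"

definition max_eigenspace :: "complex^'n^'n \<Rightarrow> (complex^'n) set" where
  "max_eigenspace A = {v. A *v v = complex_of_real (max_eigenvalue A) *s v}"

text \<open>A positive semidefinite \<open>A\<close> has exactly one positive semidefinite square root.\<close>

definition psd_sqrt :: "complex^'n^'n \<Rightarrow> complex^'n^'n" where
  "psd_sqrt A = (THE B. psd B \<and> B ** B = A)"

definition matrix_cdiv :: "complex^'n^'n \<Rightarrow> complex \<Rightarrow> complex^'n^'n" where
  "matrix_cdiv A c = map_matrix (\<lambda>z. z / c) A"

text \<open>\<open>\<sigma> / \<sigma>\<^sup>+ \<le> \<rho> / \<rho>\<^sup>+\<close>; both denominators are positive for states.\<close>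

definition qpe_le :: "complex^'n^'n \<Rightarrow> complex^'n^'n \<Rightarrow> bool"  (infix \<open>\<sqsubseteq>\<^sub>Q\<close> 50) where
  "\<rho> \<sqsubseteq>\<^sub>Q \<sigma> \<longleftrightarrow> (1 / max_eigenvalue \<sigma>) *\<^sub>R \<sigma> \<le>\<^sub>L (1 / max_eigenvalue \<rho>) *\<^sub>R \<rho>"

end

theory Submission
  imports Defs
begin

text \<open>
  If \<open>\<rho> \<sqsubseteq> \<sigma>\<close>, then \<open>C = (\<rho>\<^sup>+ / \<sigma>\<^sup>+) \<sigma> \<le> \<rho>\<close>, so \<open>E = G C G\<close> with \<open>G\<close> the pseudoinverse of
  \<open>\<rho>\<^sup>1\<^sup>/\<^sup>2\<close> is an effect that factors \<open>C\<close>; a top eigenvector of \<open>\<sigma>\<close> is then one of \<open>\<rho>\<close> and is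
  fixed by \<open>E\<close>. Conversely, a common top eigenvector of \<open>E\<close> and \<open>\<rho>\<close> shows that the bound
  \<open>\<sigma>\<^sup>+ \<le> E\<^sup>+ \<rho>\<^sup>+ / tr(E \<rho>)\<close> is attained, and \<open>E \<le> E\<^sup>+\<close> gives the order relation.

  The spectral theorem is obtained for the real inner product on \<open>complex^'n\<close>, which is the real
  part of the sesquilinear form: a hermitian matrix is a real self-adjoint operator.
\<close>

section \<open>Self-adjoint operators on a Euclidean space\<close>

definition selfadjoint :: "('a::real_inner \<Rightarrow> 'a) \<Rightarrow> bool" where
  "selfadjoint f \<longleftrightarrow> linear f \<and> (\<forall>x y. f x \<bullet> y = x \<bullet> f y)"

text \<open>A maximiser of the Rayleigh quotient is an eigenvector: perturbing it along the defect
  \<open>y = l x - f x\<close> would otherwise increase the quotient.\<close>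

lemma selfadjoint_eigenvector_in_subspace:
  fixes f :: "'a::euclidean_space \<Rightarrow> 'a"
  assumes f: "selfadjoint f" and S: "subspace S" "S \<noteq> {0}" and inv: "\<And>x. x \<in> S \<Longrightarrow> f x \<in> S"
  obtains x l where "x \<in> S" "norm x = 1" "f x = l *\<^sub>R x"
proof -
  have lin: "linear f" and adj: "\<And>x y. f x \<bullet> y = x \<bullet> f y"
    using f by (auto simp: selfadjoint_def)
  let ?K = "S \<inter> sphere 0 1"
  obtain z where z: "z \<in> S" "z \<noteq> 0"
    using S subspace_0 by fastforce
  then have "z /\<^sub>R norm z \<in> ?K"
    using S by (simp add: subspace_scale)
  then have "?K \<noteq> {}" by blast
  moreover have "compact ?K"
    using closed_subspace[OF S(1)] by (simp add: closed_Int_compact)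
  moreover have "continuous_on ?K (\<lambda>x. x \<bullet> f x)"
    using lin by (intro continuous_intros linear_continuous_on)
      (simp add: linear_conv_bounded_linear)
  ultimately obtain x where x: "x \<in> ?K" and max: "\<And>y. y \<in> ?K \<Longrightarrow> y \<bullet> f y \<le> x \<bullet> f x"
    using continuous_attains_sup by metis
  define l where "l = x \<bullet> f x"
  \<comment> \<open>Homogeneity carries maximality of \<open>l\<close> from the unit sphere to all
    of \<open>S\<close>.\<close>
  have bound: "y \<bullet> f y \<le> l * (y \<bullet> y)" if "y \<in> S" for y
  proof (cases "y = 0")
    case False
    with that S have "(y /\<^sub>R norm y) \<bullet> f (y /\<^sub>R norm y) \<le> l"
      unfolding l_def by (intro max) (simp add: subspace_scale)
    with False show ?thesis
      by (simp add: linear_scale[OF lin] field_simps dot_square_norm power2_eq_square)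
  qed (simp add: linear_0[OF lin])
  define y where "y = l *\<^sub>R x - f x"
  have xS: "x \<in> S" and xx: "x \<bullet> x = 1"
    using x by (auto simp: norm_eq_1)
  have "y \<in> S"
    unfolding y_def using S xS inv by (intro subspace_diff subspace_scale)
  have "y = 0"
  proof (rule ccontr)
    assume "y \<noteq> 0"
    define d where "d = l * (y \<bullet> y) - y \<bullet> f y"
    have "d \<ge> 0"
      using bound[OF \<open>y \<in> S\<close>] by (simp add: d_def)
    \<comment> \<open>This is \<open>bound\<close> at \<open>x - t y\<close>: the constant term
      vanishes because \<open>x\<close> attains \<open>l\<close>, and by the choice of
      \<open>y\<close> the linear coefficient is a nonzero multiple of
      \<open>y \<bullet> y\<close>.\<close>
    have main: "0 \<le> t\<^sup>2 * d - 2 * t * (y \<bullet> y)" for t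
    proof -
      have "x - t *\<^sub>R y \<in> S"
        using S xS \<open>y \<in> S\<close> by (intro subspace_diff subspace_scale)
      from bound[OF this]
      have "0 \<le> l * ((x - t *\<^sub>R y) \<bullet> (x - t *\<^sub>R y)) - (x - t *\<^sub>R y) \<bullet> f (x - t *\<^sub>R y)"
        by simp
      also have "\<dots> = t\<^sup>2 * d - 2 * t * (l * (y \<bullet> x) - y \<bullet> f x)"
        using adj[of x y] xx
        by (simp add: linear_diff[OF lin] linear_scale[OF lin] inner_simps d_def l_def
            algebra_simps power2_eq_square inner_commute)
      also have "l * (y \<bullet> x) - y \<bullet> f x = y \<bullet> y"
        by (simp add: y_def inner_simps)
      finally show ?thesis .
    qed
    have pos: "y \<bullet> y > 0" using \<open>y \<noteq> 0\<close> by simp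
    \<comment> \<open>Small enough that the quadratic term cannot compensate the linear one; the
      summand 1 guards against \<open>d = 0\<close>.\<close>
    define t where "t = (y \<bullet> y) / (d + 1)"
    have "t > 0" "t * d \<le> y \<bullet> y"
      using pos \<open>d \<ge> 0\<close> by (auto simp: t_def field_simps)
    then have "t * (t * d) < t * (2 * (y \<bullet> y))"
      using pos by (intro mult_strict_left_mono) linarith+
    then have "t\<^sup>2 * d - 2 * t * (y \<bullet> y) < 0"
      by (simp add: power2_eq_square mult_ac)
    with main[of t] show False by simp
  qed
  then show thesis
    using that[of x l] x by (simp add: y_def)
qed

text \<open>An orthonormal set of eigenvectors of greatest cardinality must span: otherwise its
  orthogonal complement is a nonzero invariant subspace and supplies one more eigenvector.\<close>

lemma selfadjoint_orthonormal_eigenbasis: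
  fixes f :: "'a::euclidean_space \<Rightarrow> 'a"
  assumes f: "selfadjoint f"
  obtains B l where "finite B" "pairwise orthogonal B" "\<And>b. b \<in> B \<Longrightarrow> norm b = 1" "span B = UNIV"
    "\<And>b. b \<in> B \<Longrightarrow> f b = l b *\<^sub>R b"
proof -
  let ?P = "\<lambda>B. pairwise orthogonal B \<and> (\<forall>b\<in>B. norm b = 1 \<and> (\<exists>l. f b = l *\<^sub>R b))"
  \<comment> \<open>Orthogonal unit vectors are independent, so the dimension bounds the
    cardinalities and a greatest one exists.\<close>
  have fin: "finite B \<and> card B \<le> DIM('a)" if "?P B" for B
  proof -
    have "0 \<notin> B" using that by force
    with that have "independent B" using pairwise_orthogonal_independent by blast
    then show ?thesis using independent_bound by blast
  qed
  have "?P {}" by simp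
  moreover have "\<forall>B. ?P B \<longrightarrow> card B < Suc DIM('a)" using fin less_Suc_eq_le by blast
  ultimately have "\<exists>B. ?P B \<and> (\<forall>C. ?P C \<longrightarrow> card C \<le> card B)"
    by (rule ex_has_greatest_nat)
  then obtain B where B: "?P B" and max: "\<And>C. ?P C \<Longrightarrow> card C \<le> card B"
    by blast
  have eig: "\<exists>l. f b = l *\<^sub>R b" if "b \<in> B" for b
    using bspec[OF conjunct2[OF B] that] by simp
  have "span B = UNIV"
  proof (rule ccontr)
    assume "span B \<noteq> UNIV"
    then obtain a where a: "a \<noteq> 0" "\<forall>x \<in> span B. a \<bullet> x = 0"
      using span_not_UNIV_orthogonal by blast
    define S where "S = {x. \<forall>b\<in>B. b \<bullet> x = 0}"
    have "subspace S"
      by (auto simp: S_def subspace_def inner_simps)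
    moreover have "a \<in> S"
      using a span_base by (auto simp: S_def inner_commute)
    then have "S \<noteq> {0}" using a by auto
    \<comment> \<open>Moving \<open>f\<close> onto the eigenvector \<open>b\<close> turns
      \<open>b \<bullet> f x\<close> into a multiple of \<open>b \<bullet> x = 0\<close>.\<close>
    moreover have "f x \<in> S" if "x \<in> S" for x
    proof -
      have "b \<bullet> f x = 0" if b: "b \<in> B" for b
      proof -
        obtain l where "f b = l *\<^sub>R b" using eig[OF b] by auto
        moreover have "f b \<bullet> x = b \<bullet> f x" using f by (simp add: selfadjoint_def)
        ultimately have "b \<bullet> f x = l * (b \<bullet> x)" by simp
        then show ?thesis using \<open>x \<in> S\<close> b by (simp add: S_def)
      qed
      then show ?thesis by (simp add: S_def)
    qed
    ultimately obtain x l where x: "x \<in> S" "norm x = 1" "f x = l *\<^sub>R x"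
      using selfadjoint_eigenvector_in_subspace[OF f] by metis
    have "?P (insert x B)"
      using B x by (auto simp: pairwise_insert S_def orthogonal_def inner_commute)
    then have "card (insert x B) \<le> card B" by (rule max)
    moreover have "x \<notin> B" using x by (auto simp: S_def)
    ultimately show False using fin[OF B] by simp
  qed
  moreover obtain l where "\<And>b. b \<in> B \<Longrightarrow> f b = l b *\<^sub>R b"
    using eig by metis
  ultimately show thesis
    using that[of B l] B fin[OF B] by simp
qed

lemma orthonormal_expansion:
  fixes v :: "'a::real_inner"
  assumes "finite B" "pairwise orthogonal B" "\<And>b. b \<in> B \<Longrightarrow> norm b = 1" "v \<in> span B"
  shows "v = (\<Sum>b\<in>B. (b \<bullet> v) *\<^sub>R b)"
proof -
  obtain u where v: "v = (\<Sum>a\<in>B. u a *\<^sub>R a)"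
    using assms(1,4) by (auto simp: span_finite)
  have "b \<bullet> v = u b" if "b \<in> B" for b
  proof -
    have "b \<bullet> v = (\<Sum>a\<in>B. if a = b then u b else 0)"
      unfolding v inner_sum_right using assms that
      by (intro sum.cong) (auto simp: pairwise_def orthogonal_def dot_square_norm)
    then show ?thesis using assms(1) that by simp
  qed
  then have "(\<Sum>b\<in>B. (b \<bullet> v) *\<^sub>R b) = (\<Sum>b\<in>B. u b *\<^sub>R b)"
    by (intro sum.cong) simp_all
  then show ?thesis
    using v by simp
qed

text \<open>The eigenvectors of \<open>f\<close> span the space. This reduces identities between
  linear maps to a check on eigenvectors.\<close>

lemma selfadjoint_eigenvectors_ext:
  fixes f :: "'a::euclidean_space \<Rightarrow> 'a"
  assumes "selfadjoint f" "linear g" "linear h" "\<And>l v. f v = l *\<^sub>R v \<Longrightarrow> g v = h v"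
  shows "g = h"
proof -
  obtain B l where "span B = UNIV" "\<And>b. b \<in> B \<Longrightarrow> f b = l b *\<^sub>R b"
    using selfadjoint_orthonormal_eigenbasis[OF assms(1)] by metis
  then show ?thesis
    using linear_eq_on_span[of g h B] assms by (metis UNIV_I ext)
qed

text \<open>Functional calculus, with \<open>g\<close> in the role of \<open>h\<close> applied to
  \<open>f\<close>. Since \<open>g\<close> is described on every eigenvector of \<open>f\<close>,
  later arguments need no reference to a chosen basis.\<close>

lemma selfadjoint_calculus:
  fixes f :: "'a::euclidean_space \<Rightarrow> 'a" and h :: "real \<Rightarrow> real"
  assumes f: "selfadjoint f"
  obtains g where "selfadjoint g" "\<And>l v. f v = l *\<^sub>R v \<Longrightarrow> g v = h l *\<^sub>R v"
proof -
  obtain B l where B: "finite B" "pairwise orthogonal B" "\<And>b. b \<in> B \<Longrightarrow> norm b = 1"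
    "span B = UNIV" and l: "\<And>b. b \<in> B \<Longrightarrow> f b = l b *\<^sub>R b"
    using selfadjoint_orthonormal_eigenbasis[OF f] by metis
  define g where "g v = (\<Sum>b\<in>B. (h (l b) * (b \<bullet> v)) *\<^sub>R b)" for v
  have "selfadjoint g"
    unfolding selfadjoint_def
  proof (intro conjI allI)
    show "linear g"
      by (intro linearI)
        (simp_all add: g_def inner_simps algebra_simps sum.distrib scaleR_sum_right)
    show "g x \<bullet> y = x \<bullet> g y" for x y
      by (simp add: g_def inner_sum_left inner_sum_right inner_commute mult_ac)
  qed
  moreover have "g v = h m *\<^sub>R v" if "f v = m *\<^sub>R v" for m v
  proof -
    \<comment> \<open>Either \<open>b\<close> is orthogonal to \<open>v\<close> or both belong to
      the same eigenvalue, as eigenvectors for distinct eigenvalues are orthogonal.\<close>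
    have "h (l b) * (b \<bullet> v) = h m * (b \<bullet> v)" if "b \<in> B" for b
    proof -
      have "f b \<bullet> v = b \<bullet> f v" using f by (simp add: selfadjoint_def)
      then have "l b * (b \<bullet> v) = m * (b \<bullet> v)"
        using l[OF that] \<open>f v = m *\<^sub>R v\<close> by simp
      then show ?thesis by auto
    qed
    then have "g v = (\<Sum>b\<in>B. h m *\<^sub>R ((b \<bullet> v) *\<^sub>R b))"
      unfolding g_def by (intro sum.cong) simp_all
    also have "\<dots> = h m *\<^sub>R (\<Sum>b\<in>B. (b \<bullet> v) *\<^sub>R b)"
      by (simp add: scaleR_sum_right)
    also have "\<dots> = h m *\<^sub>R v"
      using orthonormal_expansion[OF B(1-3)] B(4) by simp
    finally show ?thesis .
  qed
  ultimately show thesis using that by blast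
qed

text \<open>A nonzero eigenvector has a nonzero coefficient at some vector of the eigenbasis, and
  then shares its eigenvalue; so only the values \<open>l b\<close> occur.\<close>

lemma selfadjoint_finite_eigenvalues:
  fixes f :: "'a::euclidean_space \<Rightarrow> 'a"
  assumes f: "selfadjoint f"
  shows "finite {l. \<exists>v. v \<noteq> 0 \<and> f v = l *\<^sub>R v}"
proof -
  obtain B l where B: "finite B" "pairwise orthogonal B" "\<And>b. b \<in> B \<Longrightarrow> norm b = 1"
    "span B = UNIV" and l: "\<And>b. b \<in> B \<Longrightarrow> f b = l b *\<^sub>R b"
    using selfadjoint_orthonormal_eigenbasis[OF f] by metis
  have "m \<in> l ` B" if v: "v \<noteq> 0" "f v = m *\<^sub>R v" for m v
  proof -
    have "(\<Sum>b\<in>B. (b \<bullet> v) *\<^sub>R b) \<noteq> 0"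
      using orthonormal_expansion[OF B(1-3), of v] B(4) v(1) by simp
    then obtain b where b: "b \<in> B" "(b \<bullet> v) *\<^sub>R b \<noteq> 0"
      by (rule sum.not_neutral_contains_not_neutral)
    have "f b \<bullet> v = b \<bullet> f v" using f by (simp add: selfadjoint_def)
    then have "l b = m" using b l v by simp
    then show ?thesis using b by blast
  qed
  then have "{l. \<exists>v. v \<noteq> 0 \<and> f v = l *\<^sub>R v} \<subseteq> l ` B" by auto
  then show ?thesis
    using finite_imageI[OF B(1)] by (rule finite_subset)
qed

section \<open>Hermitian and positive semidefinite matrices\<close>

lemma Re_cinner: "Re (cinner v w) = v \<bullet> w"
  by (simp add: cinner_def inner_vec_def inner_complex_def Re_sum)

lemma linear_mult_vec: "linear ((*v) (A :: complex^'n^'m))"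
  by (simp add: linear_conv_bounded_linear linear_matrix_vector_mul_eq)

lemma of_real_scalar: "complex_of_real r *s v = r *\<^sub>R (v :: complex^'n)"
  by (simp add: vec_eq_iff scaleR_conv_of_real[symmetric])

lemma scaleR_mult_vec: "(c *\<^sub>R A) *v v = c *\<^sub>R (A *v (v :: complex^'n))"
  by (simp add: vec_eq_iff matrix_vector_mult_def scaleR_sum_right)

lemma mult_vec_scaleR: "A *v (c *\<^sub>R v) = c *\<^sub>R (A *v (v :: complex^'n))"
  by (simp add: vec_eq_iff matrix_vector_mult_def scaleR_sum_right)

lemma adjoint_mat_inner: "(adjoint_mat A *v v) \<bullet> w = v \<bullet> (A *v w)"
proof -
  have "(adjoint_mat A *v v) \<bullet> w = Re (\<Sum>i\<in>UNIV. \<Sum>j\<in>UNIV. cnj (v $ j) * (A $ j $ i * w $ i))"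
    unfolding Re_cinner[symmetric] cinner_def adjoint_mat_def matrix_vector_mult_def
    by (simp add: sum_distrib_left mult_ac del: Re_sum)
  also have "\<dots> = Re (\<Sum>j\<in>UNIV. \<Sum>i\<in>UNIV. cnj (v $ j) * (A $ j $ i * w $ i))"
    by (subst sum.swap) simp
  also have "\<dots> = v \<bullet> (A *v w)"
    unfolding Re_cinner[symmetric] cinner_def matrix_vector_mult_def
    by (simp add: sum_distrib_left del: Re_sum)
  finally show ?thesis .
qed

text \<open>The real inner product is nondegenerate and so determines the adjoint matrix; testing
  with real parts alone loses nothing.\<close>

lemma hermitian_iff_selfadjoint: "hermitian A \<longleftrightarrow> selfadjoint ((*v) A)"
proof
  assume "hermitian A"
  then show "selfadjoint ((*v) A)"
    using adjoint_mat_inner[of A] by (simp add: hermitian_def selfadjoint_def linear_mult_vec)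
next
  assume A: "selfadjoint ((*v) A)"
  have "adjoint_mat A *v v = A *v v" for v
  proof (rule vector_eq_rdot[THEN iffD1, rule_format])
    show "(adjoint_mat A *v v) \<bullet> w = (A *v v) \<bullet> w" for w
      using A by (simp add: adjoint_mat_inner selfadjoint_def)
  qed
  then show "hermitian A"
    by (simp add: hermitian_def matrix_eq)
qed

lemma hermitian_inner: "hermitian A \<Longrightarrow> (A *v v) \<bullet> w = v \<bullet> (A *v w)"
  by (simp add: hermitian_iff_selfadjoint selfadjoint_def)

lemma hermitianI: "(\<And>v w. (A *v v) \<bullet> w = v \<bullet> (A *v w)) \<Longrightarrow> hermitian A"
  by (simp add: hermitian_iff_selfadjoint selfadjoint_def linear_mult_vec)

lemma psd_iff: "psd A \<longleftrightarrow> hermitian A \<and> (\<forall>v. 0 \<le> v \<bullet> (A *v v))"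
  by (simp add: psd_def Re_cinner)

lemma hermitian_scaleR: "hermitian A \<Longrightarrow> hermitian (c *\<^sub>R A)"
  by (auto intro!: hermitianI simp: scaleR_mult_vec hermitian_inner)

lemma hermitian_diff: "hermitian A \<Longrightarrow> hermitian B \<Longrightarrow> hermitian (A - B)"
  by (auto intro!: hermitianI simp: matrix_vector_mult_diff_rdistrib inner_simps hermitian_inner)

lemma hermitian_mat_1: "hermitian (mat 1)"
  by (auto intro!: hermitianI)

lemma hermitian_sandwich: "hermitian A \<Longrightarrow> hermitian G \<Longrightarrow> hermitian (G ** A ** G)"
  by (auto intro!: hermitianI simp: matrix_vector_mul_assoc[symmetric] hermitian_inner)

lemma psd_scaleR: "psd A \<Longrightarrow> 0 \<le> c \<Longrightarrow> psd (c *\<^sub>R A)"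
  by (simp add: psd_iff hermitian_scaleR scaleR_mult_vec)

lemma psd_sandwich:
  assumes "psd A" "hermitian G"
  shows "psd (G ** A ** G)"
proof -
  have "v \<bullet> (G *v (A *v (G *v v))) = (G *v v) \<bullet> (A *v (G *v v))" for v
    using assms by (simp add: hermitian_inner)
  then show ?thesis
    using assms by (auto simp: psd_iff hermitian_sandwich matrix_vector_mul_assoc[symmetric])
qed

lemma psd_mult_self: "hermitian K \<Longrightarrow> psd (K ** K)"
  using psd_sandwich[of "mat 1" K] by (simp add: psd_iff hermitian_mat_1)

section \<open>Functional calculus for hermitian matrices\<close>

lemma hermitian_ext:
  assumes "hermitian A" "\<And>l v. A *v v = l *\<^sub>R v \<Longrightarrow> M *v v = N *v v"
  shows "M = (N :: complex^'n^'n)"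
proof -
  have "(*v) M = (*v) N"
    using assms by (intro selfadjoint_eigenvectors_ext[of "(*v) A"])
      (auto simp: hermitian_iff_selfadjoint linear_mult_vec)
  then show ?thesis by (metis matrix_eq)
qed

text \<open>The calculus for self-adjoint operators yields only a real-linear map; complex linearity
  has to be added before it is multiplication by a matrix.\<close>

lemma hermitian_calculus:
  fixes A :: "complex^'n^'n" and h :: "real \<Rightarrow> real"
  assumes A: "hermitian A"
  obtains H where "hermitian H" "\<And>l v. A *v v = l *\<^sub>R v \<Longrightarrow> H *v v = h l *\<^sub>R v"
proof -
  obtain g where g: "selfadjoint g" and gh: "\<And>l v. A *v v = l *\<^sub>R v \<Longrightarrow> g v = h l *\<^sub>R v"
    using selfadjoint_calculus[of "(*v) A" h] A by (auto simp: hermitian_iff_selfadjoint)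
  have lin: "linear g" using g by (simp add: selfadjoint_def)
  have J: "linear (\<lambda>v::complex^'n. \<i> *s v)"
    by (intro linearI) (simp_all add: vec_eq_iff algebra_simps)
  txt \<open>Real functional calculus commutes with \<open>\<i>\<close> because the eigenspaces are complex subspaces.\<close>
  have "(\<lambda>v. g (\<i> *s v)) = (\<lambda>v. \<i> *s g v)"
  proof (rule selfadjoint_eigenvectors_ext[of "(*v) A"])
    show "selfadjoint ((*v) A)" using A by (simp add: hermitian_iff_selfadjoint)
    show "linear (\<lambda>v. g (\<i> *s v))" "linear (\<lambda>v. \<i> *s g v)"
      using linear_compose[OF J lin] linear_compose[OF lin J] by (simp_all add: o_def)
    fix l v assume v: "A *v v = l *\<^sub>R v"
    then have "A *v (\<i> *s v) = l *\<^sub>R (\<i> *s v)"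
      by (simp add: vector_scalar_commute) (simp add: vec_eq_iff)
    then show "g (\<i> *s v) = \<i> *s g v"
      using gh[OF v] gh[of "\<i> *s v" l] by (simp add: vec_eq_iff)
  qed
  then have gi: "g (\<i> *s v) = \<i> *s g v" for v by metis
  have decomp: "c *s v = Re c *\<^sub>R v + Im c *\<^sub>R (\<i> *s v)" for c and v :: "complex^'n"
    by (simp add: vec_eq_iff complex_eq_iff)
  have "g (c *s v) = c *s g v" for c v
    by (simp add: decomp[of c] linear_add[OF lin] linear_scale[OF lin] gi)
  then have "Vector_Spaces.linear (*s) (*s) g"
    by (intro Vector_Spaces.linear.intro module_hom.intro vec.vector_space_axioms)
       (auto simp: vec.module_axioms module_hom_axioms_def linear_add[OF lin])
  then have "matrix g *v v = g v" for v
    by (rule matrix_works)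
  then have "(*v) (matrix g) = g" by blast
  then show thesis
    using that[of "matrix g"] g gh by (simp add: hermitian_iff_selfadjoint)
qed

text \<open>Taking roots of the eigenvalues exhibits \<open>A\<close> as the square of a hermitian
  matrix.\<close>

lemma hermitian_psd_if_eigenvalues_nonneg:
  assumes A: "hermitian A" and nn: "\<And>l v. v \<noteq> 0 \<Longrightarrow> A *v v = l *\<^sub>R v \<Longrightarrow> 0 \<le> l"
  shows "psd A"
proof -
  obtain H where H: "hermitian H" "\<And>l v. A *v v = l *\<^sub>R v \<Longrightarrow> H *v v = sqrt l *\<^sub>R v"
    using hermitian_calculus[OF A, of sqrt] by metis
  have "H ** H = A"
  proof (rule hermitian_ext[OF A])
    fix l v assume v: "A *v v = l *\<^sub>R v"
    show "(H ** H) *v v = A *v v"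
      using nn[OF _ v] H(2)[OF v] v
      by (cases "v = 0") (simp_all add: matrix_vector_mul_assoc[symmetric] mult_vec_scaleR)
  qed
  then show ?thesis using psd_mult_self[OF H(1)] by simp
qed

section \<open>Eigenvalues and square roots of positive semidefinite matrices\<close>

lemma psd_eigenvalue_nonneg:
  assumes "psd A" "v \<noteq> 0" "A *v v = l *\<^sub>R v"
  shows "0 \<le> l"
proof -
  have "0 \<le> v \<bullet> (A *v v)" using assms(1) by (simp add: psd_iff)
  then have "0 \<le> l * (v \<bullet> v)" using assms(3) by simp
  moreover have "0 < v \<bullet> v" using assms(2) by simp
  ultimately show ?thesis by (simp add: zero_le_mult_iff)
qed

text \<open>Eigenvectors of \<open>B\<close> are eigenvectors of \<open>A\<close> for the squared
  eigenvalue, so \<open>B\<close> agrees on them with the root \<open>H\<close> that the calculus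
  makes from \<open>A\<close>. This also carries the uniqueness of the root.\<close>

lemma psd_root_eigenvector:
  assumes B: "psd B" "B ** B = A" and v: "A *v v = l *\<^sub>R v"
  shows "B *v v = sqrt l *\<^sub>R v"
proof -
  have hB: "hermitian B" using B(1) by (simp add: psd_iff)
  have hA: "hermitian A" using psd_mult_self[OF hB] B(2) by (simp add: psd_iff)
  obtain H where H: "\<And>l v. A *v v = l *\<^sub>R v \<Longrightarrow> H *v v = sqrt l *\<^sub>R v"
    using hermitian_calculus[OF hA, of sqrt] by metis
  have "B = H"
  proof (rule hermitian_ext[OF hB])
    fix m v assume v: "B *v v = m *\<^sub>R v"
    have "A *v v = (m * m) *\<^sub>R v"
      using B(2) v by (auto simp: matrix_vector_mul_assoc[symmetric] mult_vec_scaleR)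
    \<comment> \<open>For \<open>v \<noteq> 0\<close> the eigenvalue \<open>m\<close> is
      nonnegative, whence \<open>sqrt (m * m) = m\<close>.\<close>
    from H[OF this] show "B *v v = H *v v"
      using psd_eigenvalue_nonneg[OF B(1) _ v] v by (cases "v = 0") simp_all
  qed
  then show ?thesis using H[OF v] by simp
qed

lemma psd_sqrt_ex1:
  assumes A: "psd A"
  shows "\<exists>!B. psd B \<and> B ** B = A"
proof -
  have h: "hermitian A" using A by (simp add: psd_iff)
  obtain H where H: "hermitian H" "\<And>l v. A *v v = l *\<^sub>R v \<Longrightarrow> H *v v = sqrt l *\<^sub>R v"
    using hermitian_calculus[OF h, of sqrt] by metis
  \<comment> \<open>The fourth root \<open>K\<close> shows that \<open>H\<close> is positive
    semidefinite, being the square of a hermitian matrix.\<close>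
  obtain K where K: "hermitian K"
    "\<And>l v. A *v v = l *\<^sub>R v \<Longrightarrow> K *v v = sqrt (sqrt l) *\<^sub>R v"
    using hermitian_calculus[OF h, of "\<lambda>l. sqrt (sqrt l)"] by metis
  have "H ** H = A \<and> K ** K = H"
  proof (intro conjI; rule hermitian_ext[OF h])
    fix l v assume v: "A *v v = l *\<^sub>R v"
    show "(H ** H) *v v = A *v v"
      using psd_eigenvalue_nonneg[OF A _ v] H(2)[OF v] v
      by (cases "v = 0") (simp_all add: matrix_vector_mul_assoc[symmetric] mult_vec_scaleR)
    show "(K ** K) *v v = H *v v"
      using psd_eigenvalue_nonneg[OF A _ v] K(2)[OF v] H(2)[OF v]
      by (cases "v = 0") (simp_all add: matrix_vector_mul_assoc[symmetric] mult_vec_scaleR)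
  qed
  then have H2: "H ** H = A" and "psd H"
    using psd_mult_self[OF K(1)] by auto
  moreover have "B = H" if "psd B" "B ** B = A" for B
    using hermitian_ext[OF h, of B H] psd_root_eigenvector[OF that] H(2) by metis
  ultimately show ?thesis by blast
qed

lemma
  assumes "psd A"
  shows psd_psd_sqrt: "psd (psd_sqrt A)" and psd_sqrt_square: "psd_sqrt A ** psd_sqrt A = A"
  using theI'[OF psd_sqrt_ex1[OF assms]] by (auto simp: psd_sqrt_def)

lemma hermitian_psd_sqrt: "psd A \<Longrightarrow> hermitian (psd_sqrt A)"
  using psd_psd_sqrt psd_iff by blast

lemma psd_sqrt_mult_vec: "psd A \<Longrightarrow> psd_sqrt A *v (psd_sqrt A *v v) = A *v v"
  by (simp add: matrix_vector_mul_assoc psd_sqrt_square)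

lemma psd_sqrt_eigenvector:
  "psd A \<Longrightarrow> A *v v = l *\<^sub>R v \<Longrightarrow> psd_sqrt A *v v = sqrt l *\<^sub>R v"
  using psd_root_eigenvector psd_psd_sqrt psd_sqrt_square by blast

text \<open>The form at \<open>v\<close> is the squared norm of \<open>psd_sqrt A *v v\<close>. This
  turns equality in an operator inequality into an eigenvector equation.\<close>

lemma psd_kernel:
  assumes A: "psd A" and v: "v \<bullet> (A *v v) \<le> 0"
  shows "A *v v = 0"
proof -
  have "(psd_sqrt A *v v) \<bullet> (psd_sqrt A *v v) \<le> 0"
    using v by (simp add: hermitian_inner[OF hermitian_psd_sqrt[OF A]] psd_sqrt_mult_vec[OF A])
  then have "psd_sqrt A *v v = 0" using inner_gt_zero_iff not_less by blast
  then show ?thesis using psd_sqrt_mult_vec[OF A, of v] by simp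
qed

text \<open>Diagonal entries are real by hermiticity and nonnegative by testing the form on the
  standard basis vectors.\<close>

lemma psd_trace:
  assumes A: "psd A"
  obtains r where "0 \<le> r" "trace A = complex_of_real r"
proof
  have diag: "Im (A $ i $ i) = 0 \<and> 0 \<le> Re (A $ i $ i)" for i
  proof
    have "adjoint_mat A $ i $ i = A $ i $ i" using A by (simp add: psd_def hermitian_def)
    then show "Im (A $ i $ i) = 0" by (simp add: adjoint_mat_def complex_eq_iff)
    have "0 \<le> axis i 1 \<bullet> (A *v axis i 1)" using A by (simp add: psd_iff)
    moreover have "(A *v axis i 1) $ i = A $ i $ i"
      by (simp add: matrix_vector_mult_def axis_def if_distrib cong: if_cong)
    ultimately show "0 \<le> Re (A $ i $ i)"
      by (simp add: inner_axis' inner_complex_def)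
  qed
  show "0 \<le> Re (trace A)" using diag by (simp add: trace_def Re_sum sum_nonneg)
  show "trace A = complex_of_real (Re (trace A))"
    using diag by (simp add: trace_def complex_eq_iff Im_sum)
qed

section \<open>The highest eigenvalue\<close>

text \<open>The real eigenvalues form a finite nonempty set, which gives \<open>Max\<close> its
  meaning. The third claim recognises the maximum as an eigenvalue that is also an operator upper
  bound.\<close>

lemma
  assumes A: "hermitian (A :: complex^'n^'n)"
  shows max_eigenvalue_attained: "\<exists>v. v \<noteq> 0 \<and> A *v v = max_eigenvalue A *\<^sub>R v"
    and max_eigenvalue_ge: "v \<noteq> 0 \<Longrightarrow> A *v v = l *\<^sub>R v \<Longrightarrow> l \<le> max_eigenvalue A"
    and max_eigenvalue_eqI: "v \<noteq> 0 \<Longrightarrow> A *v v = l *\<^sub>R v \<Longrightarrow> psd (l *\<^sub>R mat 1 - A) \<Longrightarrow> max_eigenvalue A = l"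
proof -
  let ?X = "{l. \<exists>v. v \<noteq> 0 \<and> A *v v = l *\<^sub>R v}"
  have sa: "selfadjoint ((*v) A)" using A by (simp add: hermitian_iff_selfadjoint)
  have fin: "finite ?X" by (rule selfadjoint_finite_eigenvalues[OF sa])
  have "axis undefined 1 \<noteq> (0 :: complex^'n)" by simp
  then have "(UNIV :: (complex^'n) set) \<noteq> {0}" by blast
  then obtain x m where "norm x = 1" "A *v x = m *\<^sub>R x"
    using selfadjoint_eigenvector_in_subspace[OF sa, of UNIV] by auto
  then have "x \<noteq> 0 \<and> A *v x = m *\<^sub>R x" by auto
  then have ne: "?X \<noteq> {}" by blast
  have eq: "max_eigenvalue A = Max ?X" by (simp add: max_eigenvalue_def of_real_scalar)
  show "\<exists>v. v \<noteq> 0 \<and> A *v v = max_eigenvalue A *\<^sub>R v" using Max_in[OF fin ne] by (simp add: eq)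
  show "l \<le> max_eigenvalue A" if "v \<noteq> 0" "A *v v = l *\<^sub>R v" for v l
    unfolding eq using that by (intro Max_ge[OF fin]) blast
  show "max_eigenvalue A = l" if v: "v \<noteq> 0" "A *v v = l *\<^sub>R v" "psd (l *\<^sub>R mat 1 - A)"
    unfolding eq
  proof (rule Max_eqI[OF fin])
    show "l \<in> ?X" using v by blast
    fix m assume "m \<in> ?X"
    then obtain w where w: "w \<noteq> 0" "A *v w = m *\<^sub>R w" by blast
    then have "(l *\<^sub>R mat 1 - A) *v w = (l - m) *\<^sub>R w"
      by (simp add: matrix_vector_mult_diff_rdistrib scaleR_mult_vec algebra_simps)
    then show "m \<le> l" using psd_eigenvalue_nonneg[OF v(3) w(1)] by fastforce
  qed
qed

text \<open>The eigenvalues of the difference are the gaps between the highest eigenvalue and the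
  eigenvalues of \<open>A\<close>.\<close>

lemma psd_max_eigenvalue_diff:
  assumes A: "hermitian A"
  shows "psd (max_eigenvalue A *\<^sub>R mat 1 - A)"
proof (rule hermitian_psd_if_eigenvalues_nonneg)
  show "hermitian (max_eigenvalue A *\<^sub>R mat 1 - A)"
    by (intro hermitian_diff hermitian_scaleR hermitian_mat_1 A)
  fix l v assume v: "v \<noteq> 0" "(max_eigenvalue A *\<^sub>R mat 1 - A) *v v = l *\<^sub>R v"
  then have "A *v v = (max_eigenvalue A - l) *\<^sub>R v"
    by (simp add: matrix_vector_mult_diff_rdistrib scaleR_mult_vec algebra_simps)
  then show "0 \<le> l" using max_eigenvalue_ge[OF A v(1)] by fastforce
qed

lemma inner_le_max_eigenvalue:
  "hermitian A \<Longrightarrow> v \<bullet> (A *v v) \<le> max_eigenvalue A * (v \<bullet> v)"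
  using psd_max_eigenvalue_diff[of A]
  by (simp add: psd_iff matrix_vector_mult_diff_rdistrib scaleR_mult_vec inner_simps)

text \<open>Otherwise the form would be nonpositive everywhere, and \<open>psd_kernel\<close> would
  annihilate every vector.\<close>

lemma psd_max_eigenvalue_pos:
  assumes A: "psd A" "A \<noteq> 0"
  shows "0 < max_eigenvalue A"
proof (rule ccontr)
  assume "\<not> 0 < max_eigenvalue A"
  then have "v \<bullet> (A *v v) \<le> 0" for v
    using inner_le_max_eigenvalue[of A v] A(1) mult_nonpos_nonneg[of "max_eigenvalue A" "v \<bullet> v"]
    by (simp add: psd_iff)
  then have "A *v v = 0" for v using psd_kernel[OF A(1)] by blast
  then have "A = 0" by (simp add: matrix_eq)
  then show False using A by simp
qed

lemma max_eigenspace_iff: "v \<in> max_eigenspace A \<longleftrightarrow> A *v v = max_eigenvalue A *\<^sub>R v"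
  by (simp add: max_eigenspace_def of_real_scalar)

lemma max_eigenspace_Int_neq_0:
  "max_eigenspace A \<inter> max_eigenspace B \<noteq> {0} \<longleftrightarrow>
    (\<exists>v. v \<noteq> 0 \<and> A *v v = max_eigenvalue A *\<^sub>R v \<and> B *v v = max_eigenvalue B *\<^sub>R v)"
proof -
  have "0 \<in> max_eigenspace A \<inter> max_eigenspace B" by (simp add: max_eigenspace_iff)
  then have "max_eigenspace A \<inter> max_eigenspace B \<noteq> {0} \<longleftrightarrow>
      (\<exists>v. v \<noteq> 0 \<and> v \<in> max_eigenspace A \<and> v \<in> max_eigenspace B)"
    by blast
  then show ?thesis unfolding max_eigenspace_iff .
qed

section \<open>Scalars and traces\<close>

lemma matrix_cdiv_of_real: "matrix_cdiv A (complex_of_real r) = (1 / r) *\<^sub>R A"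
  by (simp add: matrix_cdiv_def map_matrix_def vec_eq_iff) (simp add: complex_eq_iff)

text \<open>By cyclicity of the trace; thus the denominator in the theorem is exactly the trace of
  its numerator.\<close>

lemma trace_sandwich_psd_sqrt: "psd A \<Longrightarrow> trace (psd_sqrt A ** E ** psd_sqrt A) = trace (E ** A)"
  by (metis matrix_mul_assoc psd_sqrt_square trace_mul_sym)

lemma trace_scaleR: "trace (c *\<^sub>R (A :: complex^'n^'n)) = complex_of_real c * trace A"
  by (simp add: trace_def sum_distrib_left scaleR_conv_of_real[where 'a = complex])

section \<open>Effects and the order\<close>

lemma effect_iff: "effect E \<longleftrightarrow> psd E \<and> psd (mat 1 - E)"
  by (simp add: effect_def loewner_le_def)

text \<open>A form of Douglas' factorisation lemma; \<open>G\<close> is the pseudoinverse of the square root of \<open>A\<close>.\<close>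

lemma psd_douglas:
  assumes A: "psd A" and C: "psd C" and AC: "psd (A - C)"
  obtains G where "hermitian G" "psd (mat 1 - G ** C ** G)"
    "psd_sqrt A ** (G ** C ** G) ** psd_sqrt A = C"
    "\<And>l v. A *v v = l *\<^sub>R v \<Longrightarrow> G *v v = inverse (sqrt l) *\<^sub>R v"
proof -
  let ?S = "psd_sqrt A"
  have hS: "hermitian ?S" by (rule hermitian_psd_sqrt[OF A])
  have hA: "hermitian A" and hC: "hermitian C" using A C by (auto simp: psd_iff)
  \<comment> \<open>Since \<open>inverse 0 = 0\<close>, this \<open>G\<close> vanishes on the kernel
    of \<open>A\<close>, as a pseudoinverse should.\<close>
  obtain G where G: "hermitian G" "\<And>l v. A *v v = l *\<^sub>R v \<Longrightarrow> G *v v = inverse (sqrt l) *\<^sub>R v"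
    using hermitian_calculus[OF hA, of "\<lambda>l. inverse (sqrt l)"] by metis
  have "?S ** G = G ** ?S \<and> ?S ** G ** ?S = ?S"
  proof (intro conjI; rule hermitian_ext[OF hA])
    fix l v assume v: "A *v v = l *\<^sub>R v"
    note eig = psd_sqrt_eigenvector[OF A v] G(2)[OF v]
    show "(?S ** G) *v v = (G ** ?S) *v v" "(?S ** G ** ?S) *v v = ?S *v v"
      by (cases "l = 0"; simp add: matrix_vector_mul_assoc[symmetric] eig mult_vec_scaleR)+
  qed
  then have comm: "?S *v (G *v v) = G *v (?S *v v)"
    and SGS: "?S *v (G *v (?S *v v)) = ?S *v v" for v
    by (metis matrix_vector_mul_assoc)+
  have le: "v \<bullet> (C *v v) \<le> v \<bullet> (A *v v)" for v
    using AC by (simp add: psd_iff matrix_vector_mult_diff_rdistrib inner_simps)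
  \<comment> \<open>The defect \<open>u\<close> lies in the kernel of \<open>A\<close>, and
    \<open>0 \<le> C \<le> A\<close> makes that kernel part of the kernel of
    \<open>C\<close>.\<close>
  have CGS: "C *v (G *v (?S *v v)) = C *v v" for v
  proof -
    define u where "u = v - G *v (?S *v v)"
    have "?S *v u = 0" by (simp add: u_def matrix_vector_mult_diff_distrib SGS)
    then have "A *v u = 0" using psd_sqrt_mult_vec[OF A, of u] by simp
    then have "C *v u = 0" using psd_kernel[OF C, of u] le[of u] by simp
    then show ?thesis by (simp add: u_def matrix_vector_mult_diff_distrib)
  qed
  \<comment> \<open>The adjoint of \<open>CGS\<close>.\<close>
  have SGC: "?S *v (G *v (C *v v)) = C *v v" for v
  proof (rule vector_eq_rdot[THEN iffD1, rule_format])
    fix w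
    have "(?S *v (G *v (C *v v))) \<bullet> w = v \<bullet> (C *v (G *v (?S *v w)))"
      by (simp add: hermitian_inner hS G(1) hC)
    also have "\<dots> = (C *v v) \<bullet> w" by (simp add: CGS hermitian_inner hC)
    finally show "(?S *v (G *v (C *v v))) \<bullet> w = (C *v v) \<bullet> w" .
  qed
  have "psd (mat 1 - G ** C ** G)"
    unfolding psd_iff
  proof (intro conjI allI)
    show "hermitian (mat 1 - G ** C ** G)"
      by (intro hermitian_diff hermitian_mat_1 hermitian_sandwich hC G(1))
    fix v
    \<comment> \<open>The product of \<open>?S\<close> and \<open>G\<close> is an orthogonal
      projection, so \<open>p\<close> is no longer than \<open>v\<close>.\<close>
    define p where "p = ?S *v (G *v v)"
    have "v \<bullet> (G *v (C *v (G *v v))) = (G *v v) \<bullet> (C *v (G *v v))"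
      by (simp add: hermitian_inner G(1))
    also have "\<dots> \<le> (G *v v) \<bullet> (A *v (G *v v))" by (rule le)
    also have "\<dots> = p \<bullet> p"
      by (simp add: p_def hermitian_inner[OF hS] psd_sqrt_mult_vec[OF A])
    also have "\<dots> \<le> v \<bullet> v"
    proof -
      have "p \<bullet> p = v \<bullet> (G *v (?S *v (?S *v (G *v v))))"
        by (simp add: p_def hermitian_inner hS G(1))
      also have "\<dots> = v \<bullet> p"
        by (simp add: p_def comm SGS[unfolded comm])
      finally have pp: "p \<bullet> p = v \<bullet> p" .
      have "0 \<le> (v - p) \<bullet> (v - p)" by simp
      also have "\<dots> = v \<bullet> v - p \<bullet> p" using pp by (simp add: inner_simps inner_commute)
      finally show ?thesis by simp
    qed
    finally show "0 \<le> v \<bullet> ((mat 1 - G ** C ** G) *v v)"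
      by (simp add: matrix_vector_mult_diff_rdistrib inner_simps matrix_vector_mul_assoc[symmetric])
  qed
  moreover have "?S ** (G ** C ** G) ** ?S = C"
    by (simp add: matrix_eq matrix_vector_mul_assoc[symmetric] SGC CGS)
  ultimately show thesis using that G by blast
qed

section \<open>The two implications\<close>

lemma qpe_le_imp_effect:
  fixes \<rho> \<sigma> :: "complex^'n^'n"
  assumes \<rho>: "\<rho> \<in> states" and \<sigma>: "\<sigma> \<in> states" and le: "\<rho> \<sqsubseteq>\<^sub>Q \<sigma>"
  shows "\<exists>E. effect E \<and> trace (E ** \<rho>) \<noteq> 0 \<and>
      \<sigma> = matrix_cdiv (psd_sqrt \<rho> ** E ** psd_sqrt \<rho>) (trace (E ** \<rho>)) \<and>
      max_eigenspace E \<inter> max_eigenspace \<rho> \<noteq> {0}"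
proof -
  have p\<rho>: "psd \<rho>" and p\<sigma>: "psd \<sigma>" and tr\<sigma>: "trace \<sigma> = 1" and "\<rho> \<noteq> 0" "\<sigma> \<noteq> 0"
    using \<rho> \<sigma> by (auto simp: states_def trace_def)
  then have h\<rho>: "hermitian \<rho>" and h\<sigma>: "hermitian \<sigma>" by (auto simp: psd_iff)
  define r s where "r = max_eigenvalue \<rho>" and "s = max_eigenvalue \<sigma>"
  have "r > 0" "s > 0"
    using psd_max_eigenvalue_pos p\<rho> p\<sigma> \<open>\<rho> \<noteq> 0\<close> \<open>\<sigma> \<noteq> 0\<close> by (auto simp: r_def s_def)
  have psd_le: "psd ((1 / r) *\<^sub>R \<rho> - (1 / s) *\<^sub>R \<sigma>)"
    using le by (simp add: qpe_le_def loewner_le_def r_def s_def)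
  define C where "C = (r / s) *\<^sub>R \<sigma>"
  have "\<rho> - C = r *\<^sub>R ((1 / r) *\<^sub>R \<rho> - (1 / s) *\<^sub>R \<sigma>)"
    using \<open>r > 0\<close> by (simp add: C_def algebra_simps)
  then have dom: "psd (\<rho> - C)"
    using psd_scaleR[OF psd_le, of r] \<open>r > 0\<close> by simp
  have pC: "psd C" using \<open>r > 0\<close> \<open>s > 0\<close> by (simp add: C_def psd_scaleR p\<sigma>)
  obtain G where G: "hermitian G" and le1: "psd (mat 1 - G ** C ** G)"
    and fac: "psd_sqrt \<rho> ** (G ** C ** G) ** psd_sqrt \<rho> = C"
    and Geig: "\<And>l v. \<rho> *v v = l *\<^sub>R v \<Longrightarrow> G *v v = inverse (sqrt l) *\<^sub>R v"
    using psd_douglas[OF p\<rho> pC dom] by metis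
  define E where "E = G ** C ** G"
  have pE: "psd E" unfolding E_def by (rule psd_sandwich[OF pC G])
  \<comment> \<open>As \<open>\<sigma>\<close> has trace 1, the trace is the factor that scales
    \<open>\<sigma>\<close> to \<open>C\<close>; dividing by it gives \<open>\<sigma>\<close>
    back.\<close>
  have tr: "trace (E ** \<rho>) = complex_of_real (r / s)"
  proof -
    have "trace (E ** \<rho>) = trace C"
      unfolding trace_sandwich_psd_sqrt[OF p\<rho>, symmetric] E_def fac ..
    then show ?thesis by (simp add: C_def trace_scaleR tr\<sigma>)
  qed
  obtain v where v: "v \<noteq> 0" "\<sigma> *v v = s *\<^sub>R v"
    using max_eigenvalue_attained[OF h\<sigma>] by (auto simp: s_def)
  have Cv: "C *v v = r *\<^sub>R v"
    using \<open>s > 0\<close> by (simp add: C_def scaleR_mult_vec v)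
  \<comment> \<open>At \<open>v\<close> the form of \<open>\<rho>\<close> is at least that of
    \<open>C\<close>, which already has the largest value \<open>r\<close> allows, so the gap is
    zero there.\<close>
  have "(r *\<^sub>R mat 1 - \<rho>) *v v = 0"
  proof (rule psd_kernel)
    show "psd (r *\<^sub>R mat 1 - \<rho>)" unfolding r_def by (rule psd_max_eigenvalue_diff[OF h\<rho>])
    have "0 \<le> v \<bullet> ((\<rho> - C) *v v)" using dom by (simp add: psd_iff)
    then show "v \<bullet> ((r *\<^sub>R mat 1 - \<rho>) *v v) \<le> 0"
      by (simp add: matrix_vector_mult_diff_rdistrib scaleR_mult_vec inner_simps Cv)
  qed
  then have \<rho>v: "\<rho> *v v = r *\<^sub>R v"
    by (simp add: matrix_vector_mult_diff_rdistrib scaleR_mult_vec)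
  \<comment> \<open>The two factors \<open>inverse (sqrt r)\<close> from \<open>G\<close> cancel the
    factor \<open>r\<close> from \<open>C\<close>.\<close>
  have Ev: "E *v v = 1 *\<^sub>R v"
    using \<open>r > 0\<close> by (simp add: E_def matrix_vector_mul_assoc[symmetric] Geig[OF \<rho>v]
        mult_vec_scaleR Cv field_simps)
  have "max_eigenvalue E = 1"
    using max_eigenvalue_eqI[of E v 1] pE v Ev le1 by (simp add: psd_iff E_def)
  then have "max_eigenspace E \<inter> max_eigenspace \<rho> \<noteq> {0}"
    unfolding max_eigenspace_Int_neq_0 using v(1) Ev \<rho>v r_def by auto
  moreover have "\<sigma> = matrix_cdiv (psd_sqrt \<rho> ** E ** psd_sqrt \<rho>) (trace (E ** \<rho>))"
    unfolding tr matrix_cdiv_of_real unfolding E_def fac using \<open>r > 0\<close> \<open>s > 0\<close> by (simp add: C_def)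
  ultimately show ?thesis
    using pE le1 tr \<open>r > 0\<close> \<open>s > 0\<close> by (intro exI[of _ E]) (simp add: effect_iff E_def)
qed

lemma effect_imp_qpe_le:
  fixes \<rho> \<sigma> :: "complex^'n^'n"
  assumes \<rho>: "\<rho> \<in> states" and E: "effect E" and tr: "trace (E ** \<rho>) \<noteq> 0"
    and \<sigma>: "\<sigma> = matrix_cdiv (psd_sqrt \<rho> ** E ** psd_sqrt \<rho>) (trace (E ** \<rho>))"
    and common: "max_eigenspace E \<inter> max_eigenspace \<rho> \<noteq> {0}"
  shows "\<rho> \<sqsubseteq>\<^sub>Q \<sigma>"
proof -
  let ?S = "psd_sqrt \<rho>"
  have p\<rho>: "psd \<rho>" and "\<rho> \<noteq> 0" and pE: "psd E"
    using \<rho> E by (auto simp: states_def trace_def effect_iff)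
  have h\<rho>: "hermitian \<rho>" and hE: "hermitian E" using p\<rho> pE by (auto simp: psd_iff)
  have hS: "hermitian ?S" by (rule hermitian_psd_sqrt[OF p\<rho>])
  have "E \<noteq> 0" using tr by (auto simp: trace_def)
  define r e where "r = max_eigenvalue \<rho>" and "e = max_eigenvalue E"
  have "r > 0" "e > 0"
    using psd_max_eigenvalue_pos p\<rho> pE \<open>\<rho> \<noteq> 0\<close> \<open>E \<noteq> 0\<close> by (auto simp: r_def e_def)
  \<comment> \<open>The trace is that of a positive semidefinite sandwich, hence real and
    nonnegative; being nonzero, it is positive.\<close>
  obtain t where "0 \<le> t" and t: "trace (E ** \<rho>) = complex_of_real t"
    using psd_trace[OF psd_sandwich[OF pE hS]] trace_sandwich_psd_sqrt[OF p\<rho>, of E] by metis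
  have "t > 0" using tr t \<open>0 \<le> t\<close> by (cases "t = 0") simp_all
  have \<sigma>_eq: "\<sigma> = (1 / t) *\<^sub>R (?S ** E ** ?S)" using \<sigma> t by (simp add: matrix_cdiv_of_real)
  have h\<sigma>: "hermitian \<sigma>"
    unfolding \<sigma>_eq by (intro hermitian_scaleR hermitian_sandwich hE hS)
  \<comment> \<open>The bound of \<open>E\<close> by \<open>e\<close> times the identity, sandwiched
    between the roots of \<open>\<rho>\<close>.\<close>
  have form: "v \<bullet> (\<sigma> *v v) \<le> (e / t) * (v \<bullet> (\<rho> *v v))" for v
  proof -
    have "v \<bullet> (\<sigma> *v v) = ((?S *v v) \<bullet> (E *v (?S *v v))) / t"
      by (simp add: \<sigma>_eq scaleR_mult_vec matrix_vector_mul_assoc[symmetric] hermitian_inner[OF hS])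
    also have "\<dots> \<le> (e * ((?S *v v) \<bullet> (?S *v v))) / t"
      using inner_le_max_eigenvalue[OF hE] \<open>t > 0\<close> by (intro divide_right_mono) (auto simp: e_def)
    also have "\<dots> = (e / t) * (v \<bullet> (\<rho> *v v))"
      by (simp add: hermitian_inner[OF hS] psd_sqrt_mult_vec[OF p\<rho>])
    finally show ?thesis .
  qed
  obtain v where v: "v \<noteq> 0" "E *v v = e *\<^sub>R v" "\<rho> *v v = r *\<^sub>R v"
    using common unfolding max_eigenspace_Int_neq_0 by (auto simp: e_def r_def)
  \<comment> \<open>Each root contributes \<open>sqrt r\<close> and \<open>E\<close> contributes
    \<open>e\<close>, so the common eigenvector attains the upper bound shown next.\<close>
  have "\<sigma> *v v = (e * r / t) *\<^sub>R v"
    using \<open>r > 0\<close> by (simp add: \<sigma>_eq scaleR_mult_vec matrix_vector_mul_assoc[symmetric]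
        psd_sqrt_eigenvector[OF p\<rho> v(3)] mult_vec_scaleR v(2))
  moreover have "psd ((e * r / t) *\<^sub>R mat 1 - \<sigma>)"
    unfolding psd_iff
  proof (intro conjI allI)
    show "hermitian ((e * r / t) *\<^sub>R mat 1 - \<sigma>)"
      by (intro hermitian_diff hermitian_scaleR hermitian_mat_1 h\<sigma>)
    fix w
    have "(e / t) * (w \<bullet> (\<rho> *v w)) \<le> (e / t) * (r * (w \<bullet> w))"
      using inner_le_max_eigenvalue[OF h\<rho>] \<open>e > 0\<close> \<open>t > 0\<close>
      by (intro mult_left_mono) (auto simp: r_def)
    with form[of w] show "0 \<le> w \<bullet> (((e * r / t) *\<^sub>R mat 1 - \<sigma>) *v w)"
      by (simp add: matrix_vector_mult_diff_rdistrib scaleR_mult_vec inner_simps)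
  qed
  ultimately have s: "max_eigenvalue \<sigma> = e * r / t"
    using max_eigenvalue_eqI[OF h\<sigma> v(1)] by blast
  have "psd ((1 / r) *\<^sub>R \<rho> - (1 / max_eigenvalue \<sigma>) *\<^sub>R \<sigma>)"
    unfolding psd_iff
  proof (intro conjI allI)
    show "hermitian ((1 / r) *\<^sub>R \<rho> - (1 / max_eigenvalue \<sigma>) *\<^sub>R \<sigma>)"
      by (intro hermitian_diff hermitian_scaleR h\<rho> h\<sigma>)
    fix w
    \<comment> \<open>Dividing \<open>form\<close> by the highest eigenvalue
      \<open>e * r / t\<close> of \<open>\<sigma>\<close> turns its factor \<open>e / t\<close> into
      \<open>1 / r\<close>.\<close>
    have "t / (e * r) * (w \<bullet> (\<sigma> *v w)) \<le> t / (e * r) * ((e / t) * (w \<bullet> (\<rho> *v w)))"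
      using \<open>e > 0\<close> \<open>r > 0\<close> \<open>t > 0\<close> by (intro mult_left_mono form) simp
    also have "\<dots> = (1 / r) * (w \<bullet> (\<rho> *v w))"
      using \<open>e > 0\<close> \<open>t > 0\<close> by simp
    finally show "0 \<le> w \<bullet> (((1 / r) *\<^sub>R \<rho> - (1 / max_eigenvalue \<sigma>) *\<^sub>R \<sigma>) *v w)"
      by (simp add: matrix_vector_mult_diff_rdistrib scaleR_mult_vec inner_simps s)
  qed
  then show ?thesis by (simp add: qpe_le_def loewner_le_def r_def)
qed

theorem theorem3:
  fixes \<rho> \<sigma> :: "complex^'n^'n"
  assumes "\<rho> \<in> states" and "\<sigma> \<in> states"
  shows "\<rho> \<sqsubseteq>\<^sub>Q \<sigma> \<longleftrightarrow>
    (\<exists>E. effect E \<and> trace (E ** \<rho>) \<noteq> 0 \<and>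
      \<sigma> = matrix_cdiv (psd_sqrt \<rho> ** E ** psd_sqrt \<rho>) (trace (E ** \<rho>)) \<and>
      max_eigenspace E \<inter> max_eigenspace \<rho> \<noteq> {0})"
  using qpe_le_imp_effect[OF assms] effect_imp_qpe_le[OF assms(1)] by blast

end
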